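(* Let $a,b\geq 0$ and $n$ be integers with $b+1\leq n$. The multiplicity of the trivial representation of $S_n$ in the restriction of $W_{(a+1,1^b)}(\mathbb C^n)$ to $S_n$ equals the number of pairs $(\lambda,\mu)$ of integer sequences such that (1) $\lambda=(\lambda_1,\dotsc,\lambda_{n-b})$ with $\lambda_1\geq\cdots\geq\lambda_{n-b}\geq 0$, and $\mu=(\mu_1,\dotsc,\mu_b)$ with $\mu_1>\cdots>\mu_b\geq 0$; (2) $\lambda_1+\cdots+\lambda_{n-b}+\mu_1+\cdots+\mu_b=a+1$, and $\mu_1<\lambda_1-1$ (this last inequality being vacuous when $b=0$).
   Context: For a partition $\nu$ with at most $n$ parts, $W_\nu(\mathbb C^n)$ denotes the irreducible polynomial representation (Weyl module) of $GL_n(\mathbb C)$ indexed by $\nu$. $S_n$ is regarded as the subgroup of permutation matrices of $GL_n(\mathbb C)$. $(a+1,1^b)$ is the hook partition with first part $a+1$ followed by $b$ parts equal to $1$. *)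

theory Defs
  imports Complex_Main "HOL-Combinatorics.Permutations" "HOL-Library.Function_Algebras"
begin

text \<open>Concrete model of the Weyl module W_nu(C^n) as the image of the Young
symmetrizer of the canonical (row-reading) Young tableau of shape nu acting on
the tensor power (C^n)^{tensor k}, k = |nu|.  Tensors are coefficient functions
on words (lists of length k with letters in {0..<n}), vanishing elsewhere.\<close>

definition words :: "nat \<Rightarrow> nat \<Rightarrow> nat list set" where
  "words n k = {w. length w = k \<and> set w \<subseteq> {..<n}}"

definition tensors :: "nat \<Rightarrow> nat \<Rightarrow> (nat list \<Rightarrow> complex) set" where
  "tensors n k = {T. \<forall>w. w \<notin> words n k \<longrightarrow> T w = 0}"

definition pos_act :: "(nat \<Rightarrow> nat) \<Rightarrow> (nat list \<Rightarrow> complex) \<Rightarrow> (nat list \<Rightarrow> complex)" where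
  "pos_act p T = (\<lambda>w. T (map (\<lambda>i. w ! p i) [0..<length w]))"

text \<open>Action of a permutation sigma of {0..<n} (a permutation matrix of GL_n)
on tensors: the basis tensor e_w is sent to e_(sigma o w).\<close>
definition perm_act :: "(nat \<Rightarrow> nat) \<Rightarrow> (nat list \<Rightarrow> complex) \<Rightarrow> (nat list \<Rightarrow> complex)" where
  "perm_act \<sigma> T = (\<lambda>w. T (map (inv \<sigma>) w))"

definition row_start :: "nat list \<Rightarrow> nat \<Rightarrow> nat" where
  "row_start \<nu> i = sum_list (take i \<nu>)"

text \<open>Boxes of the canonical tableau: box (i,j) (row i, column j) carries row_start i + j.\<close>
definition tab_row :: "nat list \<Rightarrow> nat \<Rightarrow> nat set" where
  "tab_row \<nu> i = {row_start \<nu> i ..< row_start \<nu> i + \<nu> ! i}"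

definition tab_col :: "nat list \<Rightarrow> nat \<Rightarrow> nat set" where
  "tab_col \<nu> j = {row_start \<nu> i + j | i. i < length \<nu> \<and> j < \<nu> ! i}"

definition row_group :: "nat list \<Rightarrow> (nat \<Rightarrow> nat) set" where
  "row_group \<nu> = {p. p permutes {..<sum_list \<nu>} \<and> (\<forall>i<length \<nu>. p ` tab_row \<nu> i = tab_row \<nu> i)}"

definition col_group :: "nat list \<Rightarrow> (nat \<Rightarrow> nat) set" where
  "col_group \<nu> = {q. q permutes {..<sum_list \<nu>} \<and> (\<forall>j. q ` tab_col \<nu> j = tab_col \<nu> j)}"

definition young_sym :: "nat list \<Rightarrow> (nat list \<Rightarrow> complex) \<Rightarrow> (nat list \<Rightarrow> complex)" where
  "young_sym \<nu> T = (\<lambda>w. \<Sum>p\<in>row_group \<nu>. \<Sum>q\<in>col_group \<nu>.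
      of_int (sign q) * pos_act p (pos_act q T) w)"

definition weyl_module :: "nat list \<Rightarrow> nat \<Rightarrow> (nat list \<Rightarrow> complex) set" where
  "weyl_module \<nu> n = young_sym \<nu> ` tensors n (sum_list \<nu>)"

definition triv_mult :: "nat list \<Rightarrow> nat \<Rightarrow> nat" where
  "triv_mult \<nu> n = vector_space.dim (\<lambda>(c::complex) (f::nat list \<Rightarrow> complex) x. c * f x)
     {T \<in> weyl_module \<nu> n. \<forall>\<sigma>. \<sigma> permutes {..<n} \<longrightarrow> perm_act \<sigma> T = T}"

definition hook :: "nat \<Rightarrow> nat \<Rightarrow> nat list" where
  "hook a b = (a + 1) # replicate b 1"

end

theory Submission
  imports Defs
begin

text \<open>
  Elements of the Weyl module of the hook are symmetric in the arm positions, antisymmetric in the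
  leg positions, and killed by symmetrizing the arm together with one leg position. An
  \<open>S\<^sub>n\<close>-invariant such tensor is determined by its values on words indexed by pairs
  \<open>(\<lambda>, \<mu>)\<close>: \<open>\<mu>\<close> lists the multiplicities in the arm of the letters occurring in the leg, \<open>\<lambda>\<close> those of
  the remaining letters; antisymmetry makes \<open>\<mu>\<close> strict. Call a pair dominant if
  \<open>\<mu>\<^sub>1 + 1 < \<lambda>\<^sub>1\<close>. Moving the leg letter of largest multiplicity into the arm,
  \<open>(\<lambda>, \<mu>) \<mapsto> ((\<mu>\<^sub>1 + 1, \<lambda>), (\<mu>\<^sub>2, \<dots>))\<close>, is a bijection from nondominant pairs of the hook with one more leg
  box and one arm box fewer to dominant pairs, and the other terms of the Koszul differential
  never hit a dominant pair. Hence the relation above expresses each nondominant value through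
  dominant ones, while antisymmetrizing the indicator of the preimage of a dominant pair
  yields an invariant whose only nonzero dominant value is at that pair.
\<close>

subsection \<open>Invariant tensors are determined by their dominant values\<close>

definition content_word :: "nat list \<Rightarrow> (nat \<Rightarrow> nat) \<Rightarrow> nat list" where
  "content_word L f = concat (map (\<lambda>x. replicate (f x) x) L)"

lemma count_content_word:
  assumes "distinct L" "\<And>x. x \<notin> set L \<Longrightarrow> f x = 0"
  shows "count (mset (content_word L f)) = f"
proof -
  have "count (mset (content_word L f)) x = (if x \<in> set L then f x else 0)" for x
    using assms(1) by (induction L) (auto simp: content_word_def)
  then show ?thesis
    using assms(2) by fastforce
qed

lemma length_content_word: "length (content_word L f) = sum_list (map f L)"
  by (induction L) (auto simp: content_word_def)

text \<open>Up to relabelling letters and rearranging the arm, a word with distinct leg letters is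
  determined by the arm multiplicities of the letters off and on its leg. The representative uses
  the last letters as its leg, so that both lists can be read off.\<close>

definition canon_word :: "nat list \<Rightarrow> nat list \<Rightarrow> nat list" where
  "canon_word lam mu = content_word [0..<length (lam @ mu)] ((!) (lam @ mu))
     @ [length lam..<length (lam @ mu)]"

lemma map_content_word:
  "map (\<lambda>i. L ! i) (content_word [0..<length L] (\<lambda>i. f (L ! i))) = content_word L f"
proof -
  have "map (\<lambda>i. L ! i) (content_word [0..<length L] (\<lambda>i. f (L ! i)))
    = concat (map (\<lambda>x. replicate (f x) x) (map ((!) L) [0..<length L]))"
    by (simp add: content_word_def map_concat o_def)
  then show ?thesis
    by (simp add: content_word_def map_nth del: map_map)
qed

lemma content_word_cong:
  "(\<And>x. x \<in> set L \<Longrightarrow> f x = g x) \<Longrightarrow> content_word L f = content_word L g"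
  by (simp add: content_word_def cong: map_cong)

lemma count_map_transpose:
  "count (mset (map (transpose x y) u)) z = count (mset u) (transpose x y z)"
  by (induction u) (auto simp: transpose_def)

text \<open>For \<open>b = 0\<close> the entry \<open>mu ! 0\<close> is unspecified, hence the
  separate disjunct.\<close>

definition hook_pairs :: "nat \<Rightarrow> nat \<Rightarrow> nat \<Rightarrow> (nat list \<times> nat list) set" where
  "hook_pairs a b n = {(lam, mu).
       length lam = n - b \<and> sorted_wrt (\<ge>) lam \<and>
       length mu = b \<and> sorted_wrt (>) mu \<and>
       sum_list lam + sum_list mu = a + 1 \<and>
       (b = 0 \<or> mu ! 0 + 1 < lam ! 0)}"

text \<open>The properties of an invariant tensor from which its values are reconstructed.
  \<open>col_zero\<close> is the form of antisymmetry used for re-sorting the leg. In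
  \<open>garnir\<close> the first leg letter is exchanged with each arm letter in turn; the last
  summand is the trivial exchange.\<close>

locale hook_invariant =
  fixes a b n :: nat and T :: "nat list \<Rightarrow> complex"
  assumes row: "\<And>u u' v. length u = a + 1 \<Longrightarrow> length v = b \<Longrightarrow> mset u' = mset u \<Longrightarrow> T (u' @ v) = T (u @ v)"
    and col_zero: "\<And>u v v'. length u = a + 1 \<Longrightarrow> length v = b \<Longrightarrow> mset v' = mset v \<Longrightarrow>
      T (u @ v) = 0 \<Longrightarrow> T (u @ v') = 0"
    and col_swap: "\<And>u v i j. length u = a + 1 \<Longrightarrow> length v = b \<Longrightarrow> i < j \<Longrightarrow> j < b \<Longrightarrow>
      T (u @ v[i := v ! j, j := v ! i]) = - T (u @ v)"
    and garnir: "\<And>u x v. length u = a + 1 \<Longrightarrow> length v + 1 = b \<Longrightarrow>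
      (\<Sum>i<a + 1. T (u[i := x] @ u ! i # v)) + T (u @ x # v) = 0"
    and invariant: "\<And>\<sigma> w. \<sigma> permutes {..<n} \<Longrightarrow> T (map \<sigma> w) = T w"
begin

text \<open>The list \<open>off @ v\<close> enumerates all letters, so sending an index to the
  letter there is a permutation in \<open>S_n\<close>. It carries the canonical word to one with leg
  \<open>v\<close> and the same arm content as \<open>u\<close>; arm symmetry does the rest.\<close>

lemma canonical:
  assumes u: "length u = a + 1" "set u \<subseteq> {..<n}" and v: "length v = b"
    and d: "distinct (off @ v)" and s: "set (off @ v) = {..<n}"
  shows "T (u @ v) = T (canon_word (map (count (mset u)) off) (map (count (mset u)) v))"
proof -
  define L where "L = off @ v"
  have dL: "distinct L" and sL: "set L = {..<n}"
    using d s by (simp_all add: L_def)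
  have lL: "length L = n"
    using distinct_card[OF dL] sL by simp
  define \<sigma> where "\<sigma> i = (if i < n then L ! i else i)" for i
  let ?f = "count (mset u)"
  have "bij_betw ((!) L) {..<n} {..<n}"
    using bij_betw_nth[OF dL] sL lL by simp
  then have "bij_betw \<sigma> {..<n} {..<n}"
    by (rule iffD1[OF bij_betw_cong, rotated]) (simp add: \<sigma>_def)
  then have \<sigma>: "\<sigma> permutes {..<n}"
    by (rule bij_imp_permutes) (simp add: \<sigma>_def)
  have c: "canon_word (map ?f off) (map ?f v)
     = content_word [0..<n] (\<lambda>i. ?f (L ! i)) @ [length off..<n]"
    using lL unfolding canon_word_def
    by (auto simp: L_def intro!: content_word_cong simp: nth_append)
  have "set (content_word [0..<n] (\<lambda>i. ?f (L ! i))) \<subseteq> {..<n}"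
    by (auto simp: content_word_def)
  then have "map \<sigma> (content_word [0..<n] (\<lambda>i. ?f (L ! i)))
     = map (\<lambda>i. L ! i) (content_word [0..<n] (\<lambda>i. ?f (L ! i)))"
    by (auto simp: \<sigma>_def)
  also have "\<dots> = content_word L ?f"
    using map_content_word[of L ?f] lL by simp
  finally have m1: "map \<sigma> (content_word [0..<n] (\<lambda>i. ?f (L ! i))) = content_word L ?f" .
  have m2: "map \<sigma> [length off..<n] = v"
    using lL by (intro nth_equalityI) (auto simp: \<sigma>_def L_def nth_append)
  have "count (mset (content_word L ?f)) = ?f"
    using dL sL u by (intro count_content_word) (auto simp: count_eq_zero_iff)
  then have m3: "mset (content_word L ?f) = mset u"
    by (simp add: count_inject)
  have "T (canon_word (map ?f off) (map ?f v)) = T (map \<sigma> (canon_word (map ?f off) (map ?f v)))"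
    using invariant[OF \<sigma>] by simp
  also have "\<dots> = T (content_word L ?f @ v)"
    by (simp add: c m1 m2)
  also have "\<dots> = T (u @ v)"
    using u v m3 by (intro row) auto
  finally show ?thesis by simp
qed

text \<open>Swapping two equal leg letters fixes the word but negates its value.\<close>

lemma repeated_letter:
  assumes "length u = a + 1" "length v = b" "\<not> distinct v"
  shows "T (u @ v) = 0"
proof -
  obtain i j where ij: "i < j" "j < b" "v ! i = v ! j"
    using assms unfolding distinct_conv_nth by (metis nat_neq_iff)
  have "v[i := v ! j, j := v ! i] = v"
    using ij by (metis list_update_id)
  then show ?thesis
    using col_swap[OF assms(1,2) ij(1,2)] by simp
qed

text \<open>Interchanging two letters of equal arm multiplicity fixes the arm up to order and swaps
  two leg positions. Invariance and antisymmetry then give opposite signs. This is why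
  \<open>mu\<close> has to be strictly decreasing.\<close>

lemma repeated_exponent:
  assumes u: "length u = a + 1" "set u \<subseteq> {..<n}" and v: "length v = b" "set v \<subseteq> {..<n}"
    and ni: "\<not> distinct (map (count (mset u)) v)"
  shows "T (u @ v) = 0"
proof (cases "distinct v")
  case True
  obtain i j where ij: "i < j" "j < b" "count (mset u) (v ! i) = count (mset u) (v ! j)"
    using ni v(1) unfolding distinct_conv_nth by (metis length_map nat_neq_iff nth_map order.strict_trans)
  let ?\<sigma> = "transpose (v ! i) (v ! j)"
  have \<sigma>: "?\<sigma> permutes {..<n}"
    using ij v by (intro permutes_swap_id) (auto simp: subset_iff)
  have "mset (map ?\<sigma> u) = mset u"
    using ij by (intro multiset_eqI, unfold count_map_transpose) (auto simp: transpose_def)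
  then have "T (map ?\<sigma> u @ map ?\<sigma> v) = T (u @ map ?\<sigma> v)"
    using u v by (intro row) auto
  moreover have "map ?\<sigma> v = v[i := v ! j, j := v ! i]"
  proof (rule nth_equalityI)
    fix l assume l: "l < length (map ?\<sigma> v)"
    then show "map ?\<sigma> v ! l = v[i := v ! j, j := v ! i] ! l"
      using ij v True by (auto simp: nth_list_update transpose_def nth_eq_iff_index_eq)
  qed simp
  moreover have "T (map ?\<sigma> u @ map ?\<sigma> v) = T (u @ v)"
    using invariant[OF \<sigma>, of "u @ v"] by simp
  ultimately show ?thesis
    using col_swap[OF u(1) v(1) ij(1,2)] by simp
next
  case False
  then show ?thesis
    by (rule repeated_letter[OF u(1) v(1)])
qed

section \<open>Vanishing at dominant canonical words propagates to all words\<close>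

context
  assumes canon_zero: "\<And>lam mu. (lam, mu) \<in> hook_pairs a b n \<Longrightarrow> T (canon_word lam mu) = 0"
begin

text \<open>Sorting the leg and its complement by decreasing arm multiplicity turns the word into
  the canonical word of a dominant pair, unless two leg letters have equal multiplicity, where
  \<open>repeated_exponent\<close> applies.\<close>

lemma dominant_zero:
  assumes u: "length u = a + 1" "set u \<subseteq> {..<n}" and v: "length v = b" "set v \<subseteq> {..<n}"
    and dom: "b = 0 \<or> (\<exists>z<n. z \<notin> set v \<and> (\<forall>y\<in>set v. count (mset u) y + 1 < count (mset u) z))"
  shows "T (u @ v) = 0"
proof (cases "distinct (map (count (mset u)) v)")
  case True
  let ?f = "count (mset u)"
  define v' where "v' = rev (sort_key ?f v)"
  have v': "mset v' = mset v" "set v' = set v" "length v' = b"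
    using v by (auto simp: v'_def)
  define off where "off = rev (sort_key ?f (sorted_list_of_set ({..<n} - set v)))"
  have soff: "set off = {..<n} - set v" and doff: "distinct off"
    by (auto simp: off_def)
  have dv: "distinct v'" "distinct (map ?f v')"
    using True v' by (metis distinct_map mset_eq_imp_distinct_iff, metis mset_map mset_eq_imp_distinct_iff)
  have len: "length off = n - b"
    using distinct_card[OF doff] distinct_card[OF dv(1)] soff v v'
    by (simp add: card_Diff_subset)
  have eq: "T (u @ v') = T (canon_word (map ?f off) (map ?f v'))"
    using u v v' dv soff doff by (intro canonical) auto
  have srt: "sorted_wrt (\<ge>) (map ?f off)"
    using sorted_sort_key[of ?f] by (simp add: off_def sorted_wrt_rev flip: rev_map)
  have "sorted_wrt (<) (map ?f (sort_key ?f v))"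
    using dv(2) by (simp add: strict_sorted_iff v'_def flip: rev_map)
  then have srt': "sorted_wrt (>) (map ?f v')"
    by (simp add: v'_def sorted_wrt_rev flip: rev_map)
  \<comment> \<open>Every letter is listed exactly once, so the multiplicities add up to the arm
    length.\<close>
  have "sum_list (map ?f (off @ v')) = sum ?f {..<n}"
    using doff dv soff v v' by (subst sum_list_distinct_conv_sum_set) (auto intro!: sum.cong)
  also have "\<dots> = size (mset u)"
    unfolding size_multiset_overloaded_eq using u
    by (intro sum.mono_neutral_right) (auto simp: count_eq_zero_iff)
  finally have sm: "sum_list (map ?f off) + sum_list (map ?f v') = a + 1"
    using u by simp
  have "map ?f v' ! 0 + 1 < map ?f off ! 0" if b0: "b \<noteq> 0"
  proof -
    obtain z where z: "z \<in> set off" "\<forall>y\<in>set v. ?f y + 1 < ?f z"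
      using dom b0 soff by auto
    then obtain i where i: "i < length off" "off ! i = z"
      by (auto simp: in_set_conv_nth)
    have "?f z \<le> map ?f off ! 0"
      using i srt nth_map[of 0 off ?f] by (cases "i = 0"; cases off) (auto simp: nth_Cons')
    moreover have "?f (v' ! 0) + 1 < ?f z"
      using z v' b0 by auto
    ultimately show ?thesis
      using b0 v' by simp
  qed
  then have "(map ?f off, map ?f v') \<in> hook_pairs a b n"
    using len v' srt srt' sm unfolding hook_pairs_def by (simp only: length_map mem_Collect_eq prod.case) blast
  then have "T (u @ v') = 0"
    using canon_zero eq by simp
  then show ?thesis
    using col_zero[of u v' v] u v' by simp
next
  case False
  then show ?thesis
    by (rule repeated_exponent[OF u v])
qed

text \<open>In the Garnir relation every exchange term is either zero or equal to the value
  \<open>?t\<close> in question, always with the same sign. The relation therefore reads as a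
  positive integer multiple of \<open>?t\<close> being zero.\<close>

lemma nondominant_zero:
  assumes u: "length u = a + 1" "set u \<subseteq> {..<n}" and v: "length (x # v) = b" "set (x # v) \<subseteq> {..<n}"
    and mx: "\<And>y. y \<in> set v \<Longrightarrow> count (mset u) y < count (mset u) x"
    and nd: "\<And>z. z < n \<Longrightarrow> z \<notin> set v \<Longrightarrow> count (mset u) z \<le> count (mset u) x + 1"
  shows "T (u @ x # v) = 0"
proof -
  let ?f = "count (mset u)"
  let ?t = "T (u @ x # v)"
  have key: "T (u[i := x] @ u ! i # v) = 0 \<or> T (u[i := x] @ u ! i # v) = ?t" if i: "i < a + 1" for i
  proof -
    define y where "y = u ! i"
    have y: "y \<in> set u" "y < n"
      using i u(1) subsetD[OF u(2) nth_mem, of i] by (auto simp: y_def)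
    let ?u = "u[i := x]"
    have mu: "mset ?u = add_mset x (mset u - {#y#})"
      using i u by (simp add: y_def mset_update)
    \<comment> \<open>The summand for \<open>x\<close> is added before that for \<open>y\<close> is
      subtracted; \<open>y\<close> occurs in \<open>u\<close>, so the subtraction is exact.\<close>
    have cu: "count (mset ?u) z = (if z = x then 1 else 0) + ?f z - (if z = y then 1 else 0)" for z
      using y unfolding mu by auto
    have u': "length ?u = a + 1" "set ?u \<subseteq> {..<n}"
      using u v set_update_subset_insert[of u i x] by auto
    have v'': "length (y # v) = b" "set (y # v) \<subseteq> {..<n}"
      using v y by auto
    consider "y = x" | "y \<in> set v" | "y \<noteq> x" "y \<notin> set v" "?f y = ?f x + 1"
      | "y \<noteq> x" "y \<notin> set v" "?f y \<le> ?f x"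
      using nd[of y] y by force
    then show ?thesis
    proof cases
      case 1
      then have "?u = u"
        by (metis y_def list_update_id)
      then show ?thesis using 1 y_def by simp
    next
      case 2
      then show ?thesis
        using repeated_letter[OF u'(1) v''(1)] by (auto simp: y_def)
    next
      case 3
      \<comment> \<open>After the exchange \<open>x\<close> has \<open>?f x + 1 = ?f y\<close>
        copies in the arm and \<open>y\<close> has \<open>?f x\<close>, so the two letters have
        merely traded roles.\<close>
      let ?\<sigma> = "transpose x y"
      have \<sigma>: "?\<sigma> permutes {..<n}"
        using v y by (intro permutes_swap_id) auto
      have "x \<notin> set v"
        using mx by auto
      then have "map ?\<sigma> (y # v) = x # v"
        using 3 by (auto simp: transpose_def intro!: map_idI)
      moreover have "mset (map ?\<sigma> ?u) = mset u"
      proof (rule multiset_eqI)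
        fix z
        show "count (mset (map ?\<sigma> ?u)) z = ?f z"
          using 3 unfolding count_map_transpose by (auto simp: cu transpose_def)
      qed
      moreover have "T (map ?\<sigma> (?u @ y # v)) = T (?u @ y # v)"
        by (rule invariant[OF \<sigma>])
      ultimately show ?thesis
        using row[of u "x # v" "map ?\<sigma> ?u"] u v by (simp add: y_def)
    next
      case 4
      \<comment> \<open>Now \<open>x\<close> is off the leg with \<open>?f x + 1\<close> copies,
        while \<open>y\<close> keeps \<open>?f y - 1\<close> and each letter of \<open>v\<close> has
        at most \<open>?f x - 1\<close>: the new word is dominant, with \<open>x\<close> as
        witness.\<close>
      have "?f y \<noteq> 0"
        using y by (simp add: count_eq_zero_iff)
      then have "?f y - Suc 0 < ?f x" "?f y > 0"
        using 4(3) by linarith+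
      moreover have "x \<notin> set v" "x < n"
        using mx v by auto
      ultimately have "\<exists>z<n. z \<notin> set (y # v) \<and> (\<forall>y'\<in>set (y # v). count (mset ?u) y' + 1 < count (mset ?u) z)"
        using 4 mx by (intro exI[of _ x]) (auto simp: cu)
      then show ?thesis
        using dominant_zero[OF u' v''] by (simp add: y_def)
    qed
  qed
  \<comment> \<open>The identity term of the relation adds one to this count, so the total
    coefficient \<open>Suc m\<close> is nonzero in characteristic zero.\<close>
  define m where "m = card {i\<in>{..<a + 1}. T (u[i := x] @ u ! i # v) = ?t}"
  have "(\<Sum>i<a + 1. T (u[i := x] @ u ! i # v)) = (\<Sum>i<a + 1. if T (u[i := x] @ u ! i # v) = ?t then ?t else 0)"
    using key by (intro sum.cong) auto
  also have "\<dots> = of_nat m * ?t"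
    unfolding m_def by (subst sum.inter_filter[symmetric], simp, rule sum_constant)
  finally have "of_nat m * ?t + ?t = 0"
    using garnir[of u v x] u(1) v(1) by (simp only: list.size)
  then have "of_nat (Suc m) * ?t = 0"
    by (simp add: algebra_simps)
  then show ?thesis
    by (simp only: mult_eq_0_iff of_nat_eq_0_iff) simp
qed

text \<open>A word whose leg multiplicities are distinct is either dominant or, once the leg letter
  \<open>x\<close> of largest multiplicity is brought to the front of the leg, falls under
  \<open>nondominant_zero\<close>. An empty leg counts as dominant.\<close>

lemma vanishes:
  assumes "w \<in> words n (a + 1 + b)"
  shows "T w = 0"
proof -
  define u v where "u = take (a + 1) w" and "v = drop (a + 1) w"
  have w: "w = u @ v" and u: "length u = a + 1" "set u \<subseteq> {..<n}" and v: "length v = b" "set v \<subseteq> {..<n}"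
    using assms set_take_subset[of "a + 1" w] set_drop_subset[of "a + 1" w]
    by (auto simp: u_def v_def words_def)
  let ?f = "count (mset u)"
  show ?thesis
  proof (cases "distinct (map ?f v) \<and> b > 0")
    case False
    then show ?thesis
      using repeated_exponent[OF u v] dominant_zero[OF u v] w by auto
  next
    case True
    then have d: "distinct (map ?f v)" "distinct v" and ne: "set v \<noteq> {}"
      using v by (auto simp: distinct_map)
    obtain x where x: "x \<in> set v" "\<And>y. y \<in> set v \<Longrightarrow> ?f y \<le> ?f x"
      using ne Max_in[of "?f ` set v"] Max_ge[of "?f ` set v"] by fastforce
    show ?thesis
    proof (cases "\<exists>z<n. z \<notin> set v \<and> ?f x + 1 < ?f z")
      case True
      then show ?thesis
        using dominant_zero[OF u v] x w by (meson add_le_cancel_right le_less_trans)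
    next
      case nd: False
      define v' where "v' = remove1 x v"
      have m: "mset (x # v') = mset v" and s: "set v' = set v - {x}"
        using x d by (auto simp: v'_def)
      have l: "length (x # v') = b" "set (x # v') \<subseteq> {..<n}"
        using m v x s by (metis mset_eq_length, auto)
      have "T (u @ x # v') = 0"
      proof (rule nondominant_zero[OF u l])
        show "?f y < ?f x" if "y \<in> set v'" for y
          using that x(2)[of y] s inj_onD[of ?f "set v" y x] d x(1)
          by (auto simp: distinct_map intro!: le_neq_implies_less)
        show "?f z \<le> ?f x + 1" if "z < n" "z \<notin> set v'" for z
        proof (cases "z = x")
          case False
          then show ?thesis
            using that nd s by (metis Diff_iff empty_iff insert_iff not_less)
        qed simp
      qed
      then show ?thesis
        using col_zero[OF u(1) l(1) m[symmetric]] w by simp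
    qed
  qed
qed

end

end

subsection \<open>The Young symmetrizer of a hook\<close>

lemma sum_list_hook: "sum_list (hook a b) = a + 1 + b"
  by (simp add: hook_def sum_list_replicate)

lemma length_hook: "length (hook a b) = b + 1"
  by (simp add: hook_def)

lemma row_start_hook_Suc: "i \<le> b \<Longrightarrow> row_start (hook a b) (Suc i) = a + 1 + i"
  by (simp add: hook_def row_start_def sum_list_replicate)

lemma tab_row_hook_0: "tab_row (hook a b) 0 = {..<a + 1}"
  by (auto simp: tab_row_def row_start_def hook_def)

lemma tab_row_hook_Suc: "i < b \<Longrightarrow> tab_row (hook a b) (Suc i) = {a + 1 + i}"
  by (auto simp: tab_row_def row_start_hook_Suc) (auto simp: hook_def)

lemma tab_col_hook_0: "tab_col (hook a b) 0 = insert 0 {a + 1..<a + 1 + b}"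
proof -
  have "hook a b ! i > 0" if "i < b + 1" for i
    using that by (cases i) (auto simp: hook_def)
  then have "tab_col (hook a b) 0 = (\<lambda>i. row_start (hook a b) i) ` {..<b + 1}"
    by (auto simp: tab_col_def length_hook)
  also have "{..<b + 1} = insert 0 (Suc ` {..<b})"
    by (simp add: lessThan_Suc_eq_insert_0)
  also have "(\<lambda>i. row_start (hook a b) i) ` (insert 0 (Suc ` {..<b})) = insert 0 ((\<lambda>i. a + 1 + i) ` {..<b})"
    by (auto simp: row_start_hook_Suc image_iff) (simp_all add: row_start_def)
  also have "(\<lambda>i. a + 1 + i) ` {..<b} = {a + 1..<a + 1 + b}"
    using image_add_atLeastLessThan[of "a + 1" 0 b] by (simp only: lessThan_atLeast0 add_0 add.commute[of b])
  finally show ?thesis .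
qed

lemma tab_col_hook_pos: "j > 0 \<Longrightarrow> tab_col (hook a b) j = (if j \<le> a then {j} else {})"
proof -
  assume j: "j > 0"
  have "i < b + 1 \<and> j < hook a b ! i \<longleftrightarrow> i = 0 \<and> j \<le> a" for i
    using j by (cases i) (auto simp: hook_def)
  then show ?thesis
    by (auto simp: tab_col_def length_hook row_start_def)
qed

text \<open>All rows below the first are single boxes, so row permutations fix them
  pointwise.\<close>

lemma row_group_hook: "row_group (hook a b) = {p. p permutes {..<a + 1}}"
proof (intro set_eqI iffI; clarsimp)
  fix p assume "p \<in> row_group (hook a b)"
  then have p: "p permutes {..<a + 1 + b}" "\<And>i. i < b + 1 \<Longrightarrow> p ` tab_row (hook a b) i = tab_row (hook a b) i"
    unfolding row_group_def sum_list_hook length_hook by auto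
  have "p x = x" if x: "x \<in> {..<a + 1 + b} - {..<a + 1}" for x
  proof -
    have "x - (a + 1) < b" "a + 1 + (x - (a + 1)) = x"
      using x by auto
    then show ?thesis
      using p(2)[of "Suc (x - (a + 1))"] by (simp add: tab_row_hook_Suc)
  qed
  then show "p permutes {..<Suc a}"
    using permutes_superset[OF p(1), of "{..<Suc a}"] by auto
next
  fix p assume p: "p permutes {..<Suc a}"
  have "p ` tab_row (hook a b) i = tab_row (hook a b) i" if "i < b + 1" for i
    using p that permutes_image[OF p]
    by (cases i) (auto simp: tab_row_hook_0 tab_row_hook_Suc permutes_not_in)
  moreover have "p permutes {..<a + 1 + b}"
    by (rule permutes_subset[OF p]) auto
  ultimately show "p \<in> row_group (hook a b)"
    unfolding row_group_def sum_list_hook length_hook by simp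
qed

text \<open>All columns but the first have at most one box; the first consists of the corner, at
  position 0, and the leg.\<close>

lemma col_group_hook: "col_group (hook a b) = {q. q permutes insert 0 {a + 1..<a + 1 + b}}"
proof (intro set_eqI iffI; clarsimp)
  fix q assume "q \<in> col_group (hook a b)"
  then have q: "q permutes {..<a + 1 + b}" "\<And>j. q ` tab_col (hook a b) j = tab_col (hook a b) j"
    unfolding col_group_def sum_list_hook by auto
  have "q x = x" if x: "x \<in> {..<a + 1 + b} - insert 0 {a + 1..<a + 1 + b}" for x
    using q(2)[of x] x by (auto simp: tab_col_hook_pos)
  then show "q permutes insert 0 {Suc a..<Suc (a + b)}"
    using permutes_superset[OF q(1), of "insert 0 {Suc a..<Suc (a + b)}"] by auto
next
  fix q assume q: "q permutes insert 0 {Suc a..<Suc (a + b)}"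
  have "q ` tab_col (hook a b) j = tab_col (hook a b) j" for j
    using permutes_image[OF q] permutes_not_in[OF q, of j]
    by (cases "j = 0") (auto simp: tab_col_hook_0 tab_col_hook_pos)
  moreover have "q permutes {..<a + 1 + b}"
    by (rule permutes_subset[OF q]) auto
  ultimately show "q \<in> col_group (hook a b)"
    unfolding col_group_def sum_list_hook by simp
qed

text \<open>Permuting the positions of a word is a right action, so the two nested operators
  evaluate \<open>X\<close> at the word permuted by \<open>p \<circ> q\<close>, in this
  order.\<close>

lemma young_sym_hook:
  assumes "length w = a + 1 + b"
  shows "young_sym (hook a b) X w =
    (\<Sum>p | p permutes {..<a + 1}. \<Sum>q | q permutes insert 0 {a + 1..<a + 1 + b}.
      of_int (sign q) * X (permute_list (p \<circ> q) w))"
proof -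
  have "pos_act p (pos_act q X) w = X (permute_list (p \<circ> q) w)"
    if "q permutes insert 0 {a + 1..<a + 1 + b}" for p q
  proof -
    have "q permutes {..<length w}"
      by (rule permutes_subset[OF that]) (use assms in auto)
    then have "permute_list (p \<circ> q) w = permute_list q (permute_list p w)"
      by (rule permute_list_compose)
    then show ?thesis
      by (simp only: pos_act_def permute_list_def)
  qed
  then show ?thesis
    unfolding young_sym_def row_group_hook col_group_hook by (intro sum.cong refl) simp
qed

section \<open>Permuting the arm or the leg of a word\<close>

lemma permute_list_append_left:
  assumes "p permutes {..<length u}"
  shows "permute_list p (u @ v) = permute_list p u @ v"
proof (rule nth_equalityI)
  fix i assume i: "i < length (permute_list p (u @ v))"
  have p: "p permutes {..<length (u @ v)}"
    by (rule permutes_subset[OF assms]) auto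
  show "permute_list p (u @ v) ! i = (permute_list p u @ v) ! i"
    using i assms permutes_in_image[OF assms, of i] permutes_not_in[OF assms, of i]
    by (auto simp: permute_list_nth[OF p] permute_list_nth[OF assms] nth_append)
qed simp

lemma permute_list_transpose:
  assumes "i < length xs" "j < length xs"
  shows "permute_list (transpose i j) xs = xs[i := xs ! j, j := xs ! i]"
proof (rule nth_equalityI)
  fix l assume l: "l < length (permute_list (transpose i j) xs)"
  have "transpose i j permutes {..<length xs}"
    using assms by (intro permutes_swap_id) auto
  from permute_list_nth[OF this, of l] l assms
  show "permute_list (transpose i j) xs ! l = xs[i := xs ! j, j := xs ! i] ! l"
    by (auto simp: transpose_def nth_list_update)
qed simp

text \<open>A rearrangement of the leg becomes a permutation of positions after conjugation with the
  shift by \<open>length u\<close>; its support lies in the leg, as \<open>young_sym_col\<close>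
  requires.\<close>

lemma permute_list_append_right:
  assumes "mset v' = mset v"
  obtains s where "s permutes {length u..<length u + length v}" "permute_list s (u @ v) = u @ v'"
proof -
  let ?m = "length u"
  obtain r where r: "r permutes {..<length v}" "permute_list r v = v'"
    using assms by (rule mset_eq_permutation)
  define s where "s i = (if i < ?m then i else ?m + r (i - ?m))" for i
  have "bij_betw ((+) ?m \<circ> (r \<circ> (\<lambda>i. i - ?m))) {?m..<?m + length v} {?m..<?m + length v}"
  proof (intro bij_betw_trans)
    show "bij_betw (\<lambda>i. i - ?m) {?m..<?m + length v} {..<length v}"
      by (rule bij_betw_byWitness[where f' = "(+) ?m"]) auto
    show "bij_betw r {..<length v} {..<length v}"
      using r(1) by (rule permutes_imp_bij)
    show "bij_betw ((+) ?m) {..<length v} {?m..<?m + length v}"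
      by (rule bij_betw_byWitness[where f' = "\<lambda>i. i - ?m"]) auto
  qed
  then have "bij_betw s {?m..<?m + length v} {?m..<?m + length v}"
    by (rule iffD1[OF bij_betw_cong, rotated]) (simp add: s_def)
  then have s: "s permutes {?m..<?m + length v}"
    by (rule bij_imp_permutes) (auto simp: s_def permutes_not_in[OF r(1)])
  then have s': "s permutes {..<length (u @ v)}"
    by (rule permutes_subset) auto
  have "permute_list s (u @ v) = u @ permute_list r v"
  proof (rule nth_equalityI)
    fix i assume i: "i < length (permute_list s (u @ v))"
    show "permute_list s (u @ v) ! i = (u @ permute_list r v) ! i"
      using i permutes_in_image[OF r(1), of "i - ?m"]
      by (auto simp: permute_list_nth[OF s'] nth_append permute_list_nth[OF r(1)] s_def)
  qed simp
  then show thesis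
    using that s r by simp
qed

section \<open>Symmetries of the image of the Young symmetrizer\<close>

context
  fixes a b :: nat
begin

abbreviation "row_perms \<equiv> {p. p permutes {..<a + 1}}"
abbreviation "col_perms \<equiv> {q. q permutes insert 0 {a + 1..<a + 1 + b}}"

text \<open>Left multiplication by \<open>r\<close> only reindexes the outer sum.\<close>

lemma young_sym_row:
  assumes w: "length w = a + 1 + b" and r: "r permutes {..<a + 1}"
  shows "young_sym (hook a b) X (permute_list r w) = young_sym (hook a b) X w"
proof -
  have "young_sym (hook a b) X (permute_list r w) =
    (\<Sum>p\<in>row_perms. \<Sum>q\<in>col_perms. of_int (sign q) * X (permute_list (r \<circ> p \<circ> q) w))"
    unfolding young_sym_hook[of "permute_list r w" a b X, unfolded length_permute_list, OF w]
  proof (intro sum.cong refl arg_cong2[of _ _ _ _ "(*)"] arg_cong[of _ _ X])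
    fix p q assume "p \<in> row_perms" "q \<in> col_perms"
    then have "p \<circ> q permutes {..<length w}"
      using w by (auto intro!: permutes_compose intro: permutes_subset)
    then show "permute_list (p \<circ> q) (permute_list r w) = permute_list (r \<circ> p \<circ> q) w"
      by (simp add: permute_list_compose o_assoc flip: o_assoc)
  qed
  also have "\<dots> = young_sym (hook a b) X w"
    unfolding young_sym_hook[OF w]
    by (rule setum_permutations_compose_left[OF r, symmetric])
  finally show ?thesis .
qed

text \<open>The column sum stands to the right of the row sum. A permutation of the leg alone has
  support disjoint from the arm, so it commutes past \<open>p\<close> and is absorbed by the column
  sum at the cost of its sign.\<close>

lemma young_sym_col:
  assumes w: "length w = a + 1 + b" and s: "s permutes {a + 1..<a + 1 + b}"
  shows "young_sym (hook a b) X (permute_list s w) = of_int (sign s) * young_sym (hook a b) X w"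
proof -
  have sC: "s permutes insert 0 {a + 1..<a + 1 + b}"
    by (rule permutes_subset[OF s]) auto
  have "young_sym (hook a b) X (permute_list s w) =
    (\<Sum>p\<in>row_perms. \<Sum>q\<in>col_perms. of_int (sign q) * X (permute_list (p \<circ> (s \<circ> q)) w))"
    unfolding young_sym_hook[of "permute_list s w" a b X, unfolded length_permute_list, OF w]
  proof (intro sum.cong refl arg_cong2[of _ _ _ _ "(*)"] arg_cong[of _ _ X])
    fix p q assume p: "p \<in> row_perms" and q: "q \<in> col_perms"
    then have "p \<circ> q permutes {..<length w}"
      using w by (auto intro!: permutes_compose intro: permutes_subset)
    then have "permute_list (p \<circ> q) (permute_list s w) = permute_list (s \<circ> (p \<circ> q)) w"
      by (simp add: permute_list_compose)
    also have "s \<circ> p = p \<circ> s"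
    proof
      fix x
      show "(s \<circ> p) x = (p \<circ> s) x"
        using p permutes_in_image[OF s, of x] permutes_in_image[of p "{..<a + 1}" x]
          permutes_not_in[OF s, of x] permutes_not_in[OF s, of "p x"]
          permutes_not_in[of p "{..<a + 1}" x] permutes_not_in[of p "{..<a + 1}" "s x"]
        by (cases "x < a + 1"; cases "x < a + 1 + b") auto
    qed
    then have "s \<circ> (p \<circ> q) = p \<circ> (s \<circ> q)"
      by (simp add: o_assoc)
    finally show "permute_list (p \<circ> q) (permute_list s w) = permute_list (p \<circ> (s \<circ> q)) w" .
  qed
  also have "\<dots> = (\<Sum>p\<in>row_perms. \<Sum>q\<in>col_perms. of_int (sign s) * (of_int (sign (s \<circ> q)) * X (permute_list (p \<circ> (s \<circ> q)) w)))"
  proof (intro sum.cong refl)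
    fix p q assume "q \<in> col_perms"
    then have "permutation s" "permutation q"
      using permutes_imp_permutation[OF _ sC] permutes_imp_permutation[of "insert 0 {a + 1..<a + 1 + b}" q] by auto
    then show "of_int (sign q) * X (permute_list (p \<circ> (s \<circ> q)) w) =
      of_int (sign s) * (of_int (sign (s \<circ> q)) * X (permute_list (p \<circ> (s \<circ> q)) w))"
      by (simp add: sign_compose) (simp add: sign_def)
  qed
  also have "\<dots> = of_int (sign s) * young_sym (hook a b) X w"
    unfolding young_sym_hook[OF w] sum_distrib_left[symmetric]
    by (rule arg_cong[of _ _ "(*) _"], rule sum.cong[OF refl])
       (rule setum_permutations_compose_left[OF sC, symmetric])
  finally show ?thesis .
qed

text \<open>Symmetrizing over one more position than the arm kills the module: the enlarged
  symmetrizer and the column antisymmetrizer share the transposition of positions 0 and a + 1.\<close>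

lemma young_sym_garnir:
  assumes w: "length w = a + 1 + b" and b: "b > 0"
  shows "(\<Sum>i<a + 2. young_sym (hook a b) X (permute_list (transpose (a + 1) i) w)) = 0"
proof -
  define F where "F r = (\<Sum>q\<in>col_perms. of_int (sign q) * X (permute_list (r \<circ> q) w))" for r
  have ins: "insert (a + 1) {..<a + 1} = {..<a + 2}"
    by auto
  let ?t = "transpose 0 (a + 1) :: nat \<Rightarrow> nat"
  have tR: "?t permutes {..<a + 2}" and tC: "?t permutes insert 0 {a + 1..<a + 1 + b}"
    using b by (auto intro!: permutes_swap_id)
  have "(\<Sum>i<a + 2. young_sym (hook a b) X (permute_list (transpose (a + 1) i) w))
     = (\<Sum>i<a + 2. \<Sum>p\<in>row_perms. F (transpose (a + 1) i \<circ> p))"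
  proof (rule sum.cong[OF refl])
    fix i assume i: "i \<in> {..<a + 2}"
    show "young_sym (hook a b) X (permute_list (transpose (a + 1) i) w) = (\<Sum>p\<in>row_perms. F (transpose (a + 1) i \<circ> p))"
      unfolding young_sym_hook[of "permute_list (transpose (a + 1) i) w" a b X, unfolded length_permute_list, OF w] F_def
    proof (intro sum.cong refl arg_cong2[of _ _ _ _ "(*)"] arg_cong[of _ _ X])
      fix p q assume "p \<in> row_perms" "q \<in> col_perms"
      then have "p \<circ> q permutes {..<length w}"
        using w by (auto intro!: permutes_compose intro: permutes_subset)
      then show "permute_list (p \<circ> q) (permute_list (transpose (a + 1) i) w)
         = permute_list (transpose (a + 1) i \<circ> p \<circ> q) w"
        by (simp add: permute_list_compose flip: o_assoc)
    qed
  qed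
  \<comment> \<open>Coset decomposition: each permutation of the enlarged arm is uniquely
    \<open>transpose (a + 1) i \<circ> p\<close> with \<open>p\<close> in the row group;
    \<open>i = a + 1\<close> gives the trivial coset.\<close>
  also have "\<dots> = (\<Sum>r | r permutes {..<a + 2}. F r)"
    using sum_over_permutations_insert[of "{..<a + 1}" "a + 1" F] unfolding ins by simp
  finally have 1: "(\<Sum>i<a + 2. young_sym (hook a b) X (permute_list (transpose (a + 1) i) w))
     = (\<Sum>r | r permutes {..<a + 2}. F r)" .
  have "F (r \<circ> ?t) = - F r" for r
  proof -
    have "F r = (\<Sum>q\<in>col_perms. of_int (sign (?t \<circ> q)) * X (permute_list (r \<circ> (?t \<circ> q)) w))"
      unfolding F_def by (rule setum_permutations_compose_left[OF tC])
    also have "\<dots> = (\<Sum>q\<in>col_perms. - (of_int (sign q) * X (permute_list (r \<circ> ?t \<circ> q) w)))"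
    proof (intro sum.cong refl)
      fix q assume "q \<in> col_perms"
      then have "permutation q"
        using permutes_imp_permutation[of "insert 0 {a + 1..<a + 1 + b}" q] by auto
      then show "of_int (sign (?t \<circ> q)) * X (permute_list (r \<circ> (?t \<circ> q)) w)
         = - (of_int (sign q) * X (permute_list (r \<circ> ?t \<circ> q) w))"
        by (simp add: sign_compose permutation_swap_id sign_swap_id o_assoc)
    qed
    finally show ?thesis
      by (simp add: F_def sum_negf)
  qed
  \<comment> \<open>Reindexing by right multiplication with \<open>?t\<close> shows that the sum
    equals its own negative.\<close>
  then have "(\<Sum>r | r permutes {..<a + 2}. F r) = - (\<Sum>r | r permutes {..<a + 2}. F r)"
    using sum_permutations_compose_right[OF tR, of F] by (simp add: sum_negf)
  with 1 show ?thesis by simp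
qed

end

lemma young_sym_supp:
  assumes X: "X \<in> tensors n (a + 1 + b)"
  shows "young_sym (hook a b) X \<in> tensors n (a + 1 + b)"
proof -
  have "young_sym (hook a b) X w = 0" if w: "w \<notin> words n (a + 1 + b)" for w
    unfolding young_sym_def row_group_hook col_group_hook
  proof (intro sum.neutral ballI)
    fix p q assume p: "p \<in> {p. p permutes {..<a + 1}}"
      and q: "q \<in> {q. q permutes insert 0 {a + 1..<a + 1 + b}}"
    have "permute_list q (permute_list p w) \<notin> words n (a + 1 + b)"
    proof (cases "length w = a + 1 + b")
      case True
      have "p permutes {..<length w}" "q permutes {..<length w}"
        using p q True by (auto intro: permutes_subset)
      then show ?thesis
        using w by (simp add: words_def)
    next
      case False
      then show ?thesis by (simp add: words_def)
    qed
    then show "of_int (sign q) * pos_act p (pos_act q X) w = 0"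
      using X by (simp add: tensors_def pos_act_def permute_list_def)
  qed
  then show ?thesis
    by (simp add: tensors_def)
qed

definition hook_invariants :: "nat \<Rightarrow> nat \<Rightarrow> nat \<Rightarrow> (nat list \<Rightarrow> complex) set" where
  "hook_invariants a b n =
     {T \<in> weyl_module (hook a b) n. \<forall>\<sigma>. \<sigma> permutes {..<n} \<longrightarrow> perm_act \<sigma> T = T}"

text \<open>Transfers the symmetries of the symmetrizer to the arm and leg of a word, which makes
  the vanishing argument available for actual invariants.\<close>

lemma hook_invariants_hook_invariant:
  assumes T: "T \<in> hook_invariants a b n"
  shows "hook_invariant a b n T"
proof
  obtain X where X: "T = young_sym (hook a b) X"
    using T by (auto simp: hook_invariants_def weyl_module_def)
  show "T (u' @ v) = T (u @ v)" if uv: "length u = a + 1" "length v = b" and m: "mset u' = mset u" for u u' v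
  proof -
    obtain p where p: "p permutes {..<length u}" "permute_list p u = u'"
      by (rule mset_eq_permutation[OF m])
    then have "permute_list p (u @ v) = u' @ v"
      using permute_list_append_left[OF p(1), of v] by simp
    then show ?thesis
      using young_sym_row[of "u @ v" a b p X] p uv X by simp
  qed
  show "T (u @ v') = 0" if uv: "length u = a + 1" "length v = b" and m: "mset v' = mset v" and z: "T (u @ v) = 0" for u v v'
  proof -
    obtain s where "s permutes {length u..<length u + length v}" "permute_list s (u @ v) = u @ v'"
      by (rule permute_list_append_right[OF m])
    then show ?thesis
      using young_sym_col[of "u @ v" a b s X] uv z X by simp
  qed
  show "T (u @ v[i := v ! j, j := v ! i]) = - T (u @ v)"
    if uv: "length u = a + 1" "length v = b" and ij: "i < j" "j < b" for u v i j
  proof -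
    let ?s = "transpose (a + 1 + i) (a + 1 + j)"
    have s: "?s permutes {a + 1..<a + 1 + b}"
      using ij by (intro permutes_swap_id) auto
    have "permute_list ?s (u @ v) = u @ v[i := v ! j, j := v ! i]"
      using uv ij by (simp add: permute_list_transpose list_update_append nth_append)
    then show ?thesis
      using young_sym_col[OF _ s, of "u @ v" X] uv ij X by (simp add: sign_swap_id)
  qed
  show "(\<Sum>i<a + 1. T (u[i := x] @ u ! i # v)) + T (u @ x # v) = 0"
    if uv: "length u = a + 1" "length v + 1 = b" for u x v
  proof -
    let ?w = "u @ x # v"
    have eq: "permute_list (transpose (a + 1) i) ?w = u[i := x] @ u ! i # v" if "i < a + 1" for i
      using uv that by (simp add: permute_list_transpose list_update_append nth_append)
    \<comment> \<open>The last index \<open>a + 1\<close> is the identity transposition and yields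
      the separate summand of the relation.\<close>
    have "0 = (\<Sum>i<Suc (a + 1). T (permute_list (transpose (a + 1) i) ?w))"
      using young_sym_garnir[of ?w a b X] uv X by simp
    also have "\<dots> = (\<Sum>i<a + 1. T (permute_list (transpose (a + 1) i) ?w)) + T ?w"
      by (subst sum.lessThan_Suc) simp
    also have "(\<Sum>i<a + 1. T (permute_list (transpose (a + 1) i) ?w)) = (\<Sum>i<a + 1. T (u[i := x] @ u ! i # v))"
      by (rule sum.cong[OF refl]) (simp only: eq lessThan_iff)
    finally show ?thesis by simp
  qed
  show "T (map \<sigma> w) = T w" if \<sigma>: "\<sigma> permutes {..<n}" for \<sigma> w
  proof -
    have "perm_act (inv \<sigma>) T = T"
      using T permutes_inv[OF \<sigma>] by (auto simp: hook_invariants_def)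
    then have "perm_act (inv \<sigma>) T w = T w"
      by simp
    then show ?thesis
      using \<sigma> by (simp add: perm_act_def permutes_inv_inv)
  qed
qed

subsection \<open>Dual elements\<close>

text \<open>The orbit that the differential sends to \<open>(lam, mu)\<close>: position 0 joins the leg, its letter
  having multiplicity \<open>hd lam - 1\<close> in the rest of the arm.\<close>

definition hook_type :: "nat \<Rightarrow> nat \<Rightarrow> nat \<Rightarrow> nat list \<Rightarrow> nat list \<Rightarrow> nat list \<Rightarrow> bool" where
  "hook_type a b n lam mu w \<longleftrightarrow> w \<in> words n (a + 1 + b) \<and>
     (let cs = w ! 0 # drop (a + 1) w; f = count (mset (take a (tl w))) in
        distinct cs \<and> map f cs = (hd lam - 1) # mu \<and>
        image_mset f (mset_set ({..<n} - set cs)) = mset (tl lam))"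

lemma count_map_inj: "inj \<sigma> \<Longrightarrow> count (mset (map \<sigma> xs)) (\<sigma> x) = count (mset xs) x"
  by (induction xs) (auto simp: inj_eq)

text \<open>The type depends only on positions and multiplicities, which a relabelling of the
  letters carries along.\<close>

lemma hook_type_map:
  assumes \<sigma>: "\<sigma> permutes {..<n}" and w: "hook_type a b n lam mu w"
  shows "hook_type a b n lam mu (map \<sigma> w)"
proof -
  have inj: "inj \<sigma>"
    using \<sigma> by (rule permutes_inj)
  have im: "\<sigma> ` {..<n} = {..<n}"
    using \<sigma> by (rule permutes_image)
  have ww: "w \<in> words n (a + 1 + b)"
    using w by (simp add: hook_type_def)
  then have ww': "map \<sigma> w \<in> words n (a + 1 + b)"
    using im by (auto simp: words_def)
  define cs f where "cs = w ! 0 # drop (a + 1) w" and "f = count (mset (take a (tl w)))"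
  define f' where "f' = count (mset (take a (tl (map \<sigma> w))))"
  have cs': "map \<sigma> w ! 0 # drop (a + 1) (map \<sigma> w) = map \<sigma> cs"
    using ww by (simp add: cs_def drop_map words_def)
  have f': "f' (\<sigma> x) = f x" for x
    using count_map_inj[OF inj, of "take a (tl w)" x] by (simp only: f'_def f_def take_map flip: map_tl)
  have "{..<n} - set (map \<sigma> cs) = \<sigma> ` ({..<n} - set cs)"
    using im by (simp add: image_set_diff[OF inj])
  then have "image_mset f' (mset_set ({..<n} - set (map \<sigma> cs)))
     = image_mset f' (image_mset \<sigma> (mset_set ({..<n} - set cs)))"
    using inj by (simp add: image_mset_mset_set inj_on_def)
  also have "\<dots> = image_mset f (mset_set ({..<n} - set cs))"
    by (simp add: image_mset.compositionality o_def f')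
  finally have "image_mset f' (mset_set ({..<n} - set (map \<sigma> cs))) = image_mset f (mset_set ({..<n} - set cs))" .
  moreover have "map f' (map \<sigma> cs) = map f cs"
    by (simp add: f')
  moreover have "distinct (map \<sigma> cs) = distinct cs"
    using inj_on_subset[OF inj] by (simp add: distinct_map)
  ultimately show ?thesis
    using w ww' unfolding hook_type_def Let_def cs' f'_def[symmetric]
      cs_def[symmetric] f_def[symmetric] by simp
qed

lemma hook_type_map_iff:
  assumes "\<sigma> permutes {..<n}"
  shows "hook_type a b n lam mu (map \<sigma> w) = hook_type a b n lam mu w"
proof
  assume "hook_type a b n lam mu (map \<sigma> w)"
  from hook_type_map[OF permutes_inv[OF assms] this] show "hook_type a b n lam mu w"
    using permutes_inv_o[OF assms] by simp
qed (rule hook_type_map[OF assms])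

text \<open>Relabelling letters commutes with permuting positions, so symmetrizing preserves
  invariance.\<close>

lemma young_sym_invariant:
  assumes X: "X \<in> tensors n (a + 1 + b)"
    and inv: "\<And>\<sigma> w. \<sigma> permutes {..<n} \<Longrightarrow> X (map \<sigma> w) = X w"
  shows "young_sym (hook a b) X \<in> hook_invariants a b n"
proof -
  have "young_sym (hook a b) X (map (inv \<sigma>) w) = young_sym (hook a b) X w"
    if \<sigma>: "\<sigma> permutes {..<n}" for \<sigma> w
  proof (cases "length w = a + 1 + b")
    case True
    have \<sigma>': "inv \<sigma> permutes {..<n}"
      using \<sigma> by (rule permutes_inv)
    have "young_sym (hook a b) X (map (inv \<sigma>) w) = (\<Sum>p | p permutes {..<a + 1}. \<Sum>q | q permutes insert 0 {a + 1..<a + 1 + b}.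
      of_int (sign q) * X (permute_list (p \<circ> q) (map (inv \<sigma>) w)))"
      using True by (intro young_sym_hook) simp
    also have "\<dots> = (\<Sum>p | p permutes {..<a + 1}. \<Sum>q | q permutes insert 0 {a + 1..<a + 1 + b}.
      of_int (sign q) * X (permute_list (p \<circ> q) w))"
    proof (intro sum.cong refl arg_cong2[of _ _ _ _ "(*)"])
      fix p q assume "p \<in> {p. p permutes {..<a + 1}}" "q \<in> {q. q permutes insert 0 {a + 1..<a + 1 + b}}"
      then have "p \<circ> q permutes {..<length w}"
        using True by (auto intro!: permutes_compose intro: permutes_subset)
      then show "X (permute_list (p \<circ> q) (map (inv \<sigma>) w)) = X (permute_list (p \<circ> q) w)"
        by (simp add: permute_list_map inv[OF \<sigma>'])
    qed
    finally show ?thesis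
      using young_sym_hook[OF True] by simp
  next
    case False
    then have "w \<notin> words n (a + 1 + b)" "map (inv \<sigma>) w \<notin> words n (a + 1 + b)"
      by (auto simp: words_def)
    then show ?thesis
      using young_sym_supp[OF X] by (simp add: tensors_def)
  qed
  then show ?thesis
    using X by (auto simp: hook_invariants_def weyl_module_def perm_act_def sum_list_hook)
qed

section \<open>Types of permuted canonical words\<close>

lemma sorted_wrt_ge_unique:
  fixes xs ys :: "nat list"
  assumes "sorted_wrt (\<ge>) xs" "sorted_wrt (\<ge>) ys" "mset xs = mset ys"
  shows "xs = ys"
proof -
  have "sorted (rev xs)" "sorted (rev ys)"
    using assms by (simp_all add: sorted_wrt_rev)
  then have "rev xs = rev ys"
    using assms(3) by (metis mset_rev properties_for_sort)
  then show ?thesis by simp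
qed

lemma sorted_wrt_gt_imp_ge: "sorted_wrt (>) (xs :: nat list) \<Longrightarrow> sorted_wrt (\<ge>) xs"
  by (erule sorted_wrt_mono_rel[rotated]) simp

lemma sorted_wrt_ge_nth_0: "sorted_wrt (\<ge>) (xs :: nat list) \<Longrightarrow> x \<in> set xs \<Longrightarrow> x \<le> xs ! 0"
  by (cases xs) auto

text \<open>Makes the subtraction \<open>hd lam - 1\<close> in \<open>hook_type\<close> exact. A
  zero first part would force \<open>b = 0\<close> by dominance, and then the total would be 0
  instead of \<open>a + 1\<close>.\<close>

lemma hook_pairs_hd_pos:
  assumes "(lam, mu) \<in> hook_pairs a b n" "b + 1 \<le> n"
  shows "lam \<noteq> []" "lam ! 0 > 0"
proof -
  show ne: "lam \<noteq> []"
    using assms by (auto simp: hook_pairs_def)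
  show "lam ! 0 > 0"
  proof (rule ccontr)
    assume "\<not> lam ! 0 > 0"
    then have z: "lam ! 0 = 0" by simp
    then have "b = 0" "mu = []"
      using assms by (auto simp: hook_pairs_def)
    moreover have "x = 0" if "x \<in> set lam" for x
      using sorted_wrt_ge_nth_0[OF _ that] assms z by (auto simp: hook_pairs_def)
    then have "sum_list lam = 0"
      by (simp add: sum_list_eq_0_iff)
    moreover have "sum_list lam + sum_list mu = a + 1"
      using assms by (simp add: hook_pairs_def)
    ultimately show False
      by (metis add_eq_0_iff_both_eq_0 sum_list.Nil zero_neq_one)
  qed
qed

text \<open>As the first part of \<open>lam\<close> is positive, the corner of the canonical word
  carries the letter 0. Splitting it off prepares for column permutations, which act on the corner
  and the leg.\<close>

lemma canon_word_split:
  assumes A: "(lam, mu) \<in> hook_pairs a b n" and bn: "b + 1 \<le> n"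
  obtains u where "canon_word lam mu = (0 # u) @ [n - b..<n]" "length u = a" "set u \<subseteq> {..<n}"
    "map (count (mset (0 # u))) [0..<n - b] = lam"
    "map (count (mset (0 # u))) [n - b..<n] = mu"
proof -
  let ?c = "lam @ mu"
  let ?u = "content_word [0..<n] ((!) ?c)"
  have len: "length lam = n - b" "length mu = b" "length ?c = n"
    using A bn by (auto simp: hook_pairs_def)
  have cnt: "count (mset ?u) i = ?c ! i" if "i < n" for i
  proof -
    \<comment> \<open>Entries beyond the end of a list are unspecified, so the multiplicity function
      is cut off by zero before counting.\<close>
    have "?u = content_word [0..<n] (\<lambda>i. if i < n then ?c ! i else 0)"
      by (rule content_word_cong) simp
    then show ?thesis
      using count_content_word[of "[0..<n]" "\<lambda>i. if i < n then ?c ! i else 0"] that by simp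
  qed
  have "?u = replicate (?c ! 0) 0 @ content_word [1..<n] ((!) ?c)"
    using bn by (simp add: upt_conv_Cons content_word_def)
  moreover have "?c ! 0 > 0"
    using hook_pairs_hd_pos[OF A bn] by (simp add: nth_append)
  ultimately obtain u where u: "?u = 0 # u"
    by (cases "?c ! 0") auto
  have "map ((!) ?c) [0..<n] = ?c"
    using len by (metis map_nth)
  then have "length ?u = a + 1"
    using A by (simp add: length_content_word hook_pairs_def)
  moreover have "set ?u \<subseteq> {..<n}"
    by (auto simp: content_word_def)
  moreover have "canon_word lam mu = ?u @ [n - b..<n]"
    using len by (simp add: canon_word_def)
  moreover have "map (count (mset ?u)) [0..<n - b] = lam"
    by (rule nth_equalityI) (use len cnt in \<open>auto simp: nth_append\<close>)
  moreover have "map (count (mset ?u)) [n - b..<n] = mu"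
    by (rule nth_equalityI) (use len bn cnt in \<open>auto simp: nth_append\<close>)
  ultimately show thesis
    using that[of u] unfolding u by simp
qed

lemma mset_set_remove_upt:
  assumes "y < m"
  shows "mset (map f [0..<m]) = add_mset (f y) (image_mset f (mset_set ({..<m} - {y})))"
proof -
  have "mset (map f [0..<m]) = image_mset f (mset_set {..<m})"
    by (simp add: lessThan_atLeast0)
  also have "mset_set {..<m} = add_mset y (mset_set ({..<m} - {y}))"
    using assms by (intro mset_set.remove) auto
  finally show ?thesis by simp
qed

lemma hook_type_canon_word:
  assumes A: "(lam, mu) \<in> hook_pairs a b n" and bn: "b + 1 \<le> n"
  shows "hook_type a b n lam mu (canon_word lam mu)"
proof -
  obtain u where u: "canon_word lam mu = (0 # u) @ [n - b..<n]" "length u = a" "set u \<subseteq> {..<n}"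
    "map (count (mset (0 # u))) [0..<n - b] = lam"
    "map (count (mset (0 # u))) [n - b..<n] = mu"
    by (rule canon_word_split[OF A bn])
  let ?w = "canon_word lam mu" and ?f = "count (mset u)" and ?g = "count (mset (0 # u))"
  obtain l0 ls where lam: "lam = l0 # ls"
    using hook_pairs_hd_pos[OF A bn] by (cases lam) auto
  have "?w \<in> words n (a + 1 + b)"
    using u bn by (auto simp: words_def)
  moreover have cs: "?w ! 0 # drop (a + 1) ?w = 0 # [n - b..<n]" "take a (tl ?w) = u"
    using u by simp_all
  moreover have "distinct (0 # [n - b..<n])"
    using bn by simp
  moreover have "map ?f (0 # [n - b..<n]) = (hd lam - 1) # mu"
  proof -
    have "?g 0 = l0"
      using u(4) lam bn by (simp add: upt_conv_Cons)
    moreover have "map ?f [n - b..<n] = map ?g [n - b..<n]"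
      using bn by auto
    ultimately show ?thesis
      using u(5) lam by auto
  qed
  moreover have "image_mset ?f (mset_set ({..<n} - set (0 # [n - b..<n]))) = mset (tl lam)"
  proof -
    have "{..<n} - set (0 # [n - b..<n]) = {..<n - b} - {0}"
      by auto
    moreover have "image_mset ?f (mset_set ({..<n - b} - {0})) = image_mset ?g (mset_set ({..<n - b} - {0}))"
      by (rule image_mset_cong) auto
    moreover have "mset lam = add_mset (?g 0) (image_mset ?g (mset_set ({..<n - b} - {0})))"
      using mset_set_remove_upt[of 0 "n - b" ?g, unfolded u(4)] bn by (metis Suc_eq_plus1 Suc_le_eq zero_less_diff)
    moreover have "?g 0 = l0"
      using u(4) lam bn by (simp add: upt_conv_Cons)
    ultimately show ?thesis
      using lam by simp
  qed
  ultimately show ?thesis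
    unfolding hook_type_def Let_def by simp
qed

text \<open>This excludes cancellation and off-diagonal values when a dual element is evaluated.
  Dominance of both pairs prevents \<open>q\<close> from moving the corner letter into the leg;
  strictness of \<open>mu\<close> then fixes the order of the leg.\<close>

lemma hook_type_permuted_canon_word:
  assumes A: "(lam, mu) \<in> hook_pairs a b n" and A': "(lam', mu') \<in> hook_pairs a b n" and bn: "b + 1 \<le> n"
    and p: "p permutes {..<a + 1}" and q: "q permutes insert 0 {a + 1..<a + 1 + b}"
    and type: "hook_type a b n lam mu (permute_list (p \<circ> q) (canon_word lam' mu'))"
  shows "q = id \<and> lam' = lam \<and> mu' = mu"
proof -
  obtain u0 where u0: "canon_word lam' mu' = (0 # u0) @ [n - b..<n]" "length u0 = a" "set u0 \<subseteq> {..<n}"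
    "map (count (mset (0 # u0))) [0..<n - b] = lam'"
    "map (count (mset (0 # u0))) [n - b..<n] = mu'"
    by (rule canon_word_split[OF A' bn])
  define u where "u = 0 # u0"
  define v where "v = [n - b..<n]"
  define g where "g = count (mset u)"
  have lu: "length u = a + 1" and su: "set u \<subseteq> {..<n}"
    using u0 bn by (auto simp: u_def)
  have lv: "length v = b" and dv: "distinct v" and sv: "set v = {n - b..<n}"
    using bn by (auto simp: v_def)
  have gl: "map g [0..<n - b] = lam'" and gm: "map g v = mu'"
    using u0 by (simp_all add: g_def u_def v_def)
  have p': "p permutes {..<length u}"
    using p lu by simp
  obtain y0 ur where yu: "permute_list p u = y0 # ur"
    using lu by (cases "permute_list p u") (auto dest: arg_cong[of _ _ length])
  have mu_: "mset u = add_mset y0 (mset ur)"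
    using mset_permute_list[OF p'] yu by simp
  have lur: "length ur = a"
    using lu arg_cong[OF yu, of length] by simp
  define y where "y = y0 # ur @ v"
  have y: "y = permute_list p (u @ v)"
    using permute_list_append_left[OF p', of v] yu by (simp add: y_def)
  have q': "q permutes {..<length y}"
    by (rule permutes_subset[OF q]) (auto simp: y_def lur lv)
  define z where "z = permute_list q y"
  have z: "z = permute_list (p \<circ> q) (canon_word lam' mu')"
    unfolding z_def y
    using q' u0(1) by (subst permute_list_compose) (auto simp: u_def v_def y)
  have lz: "length z = a + 1 + b"
    by (simp add: z_def y_def lur lv)
  \<comment> \<open>Column permutations fix the arm positions other than the corner.\<close>
  have tz: "take a (tl z) = ur"
  proof (rule nth_equalityI)
    show "length (take a (tl z)) = length ur"
      using lz lur by simp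
    fix i assume "i < length (take a (tl z))"
    then have i: "i < a" by simp
    then have "take a (tl z) ! i = z ! Suc i"
      using lz by (simp add: nth_tl)
    also have "\<dots> = y ! q (Suc i)"
      unfolding z_def using i by (intro permute_list_nth[OF q']) (simp add: y_def lur)
    also have "q (Suc i) = Suc i"
      using i by (intro permutes_not_in[OF q]) auto
    finally show "take a (tl z) ! i = ur ! i"
      using i lur by (simp add: y_def nth_append)
  qed
  define c0 cr where "c0 = z ! 0" and "cr = drop (a + 1) z"
  have zs: "z = c0 # ur @ cr"
  proof -
    have "z = z ! 0 # tl z"
      using lz by (cases z) auto
    moreover have "tl z = take a (tl z) @ drop a (tl z)"
      by simp
    moreover have "drop a (tl z) = cr"
      by (simp add: cr_def drop_Suc)
    ultimately show ?thesis
      using tz c0_def by metis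
  qed
  have mc: "mset (c0 # cr) = mset (y0 # v)"
  proof -
    have "mset z = mset y"
      unfolding z_def by (rule mset_permute_list[OF q'])
    then show ?thesis
      by (simp add: zs y_def)
  qed
  let ?f = "count (mset ur)"
  obtain l0 ls where lam: "lam = l0 # ls"
    using hook_pairs_hd_pos[OF A bn] by (cases lam) auto
  have l0: "l0 > 0"
    using hook_pairs_hd_pos[OF A bn] lam by simp
  have ty: "distinct (c0 # cr)" "?f c0 = l0 - 1" "map ?f cr = mu"
    "image_mset ?f (mset_set ({..<n} - set (c0 # cr))) = mset ls"
    using type unfolding z[symmetric] hook_type_def Let_def tz c0_def[symmetric] cr_def[symmetric] lam
    by simp_all
  \<comment> \<open>\<open>g\<close> counts in the whole arm, \<open>?f\<close> in the arm without
    its corner letter \<open>y0\<close>.\<close>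
  have gf: "g x = (if x = y0 then Suc (?f x) else ?f x)" for x
    by (simp add: g_def mu_)
  have sc: "set (c0 # cr) = set (y0 # v)"
    using mc by (metis set_mset_mset)
  have dy: "distinct (y0 # v)"
    using ty(1) mc by (metis mset_eq_imp_distinct_iff)
  have y0: "y0 < n - b"
  proof -
    have "y0 \<in> set u"
      using mu_ by (metis set_mset_mset union_single_eq_member)
    then show ?thesis
      using su dy sv by auto
  qed
  have srt: "sorted_wrt (\<ge>) lam" "sorted_wrt (\<ge>) lam'" "sorted_wrt (>) mu" "sorted_wrt (>) mu'"
    using A A' by (auto simp: hook_pairs_def)
  have bounds: "m + 1 < l0" if "m \<in> set mu" for m
    using that sorted_wrt_ge_nth_0[OF sorted_wrt_gt_imp_ge[OF srt(3)] that] A lam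
    by (auto simp: hook_pairs_def)
  have bounds': "m + 1 < lam' ! 0" if "m \<in> set mu'" for m
    using that sorted_wrt_ge_nth_0[OF sorted_wrt_gt_imp_ge[OF srt(4)] that] A'
    by (auto simp: hook_pairs_def)
  have g0: "g 0 = lam' ! 0"
    using gl bn by (auto simp: upt_conv_Cons)
  have c0: "c0 = y0"
  proof (rule ccontr)
    assume ne: "c0 \<noteq> y0"
    then have "c0 \<in> set v" "y0 \<in> set cr"
      using sc by auto
    then have "g c0 \<in> set mu'"
      using gm by auto
    \<comment> \<open>\<open>c0\<close> comes from the old leg, where it has multiplicity
      \<open>l0 - 1\<close>; dominance of the second pair gives the bound. The letter 0 now has too
      many copies for the first pair: if it is \<open>y0\<close>, it sits in the new leg with at
      least \<open>l0\<close> copies; otherwise it is off the leg with more than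
      \<open>l0\<close>.\<close>
    then have lt: "l0 < lam' ! 0"
      using bounds' ty(2) l0 gf ne by fastforce
    show False
    proof (cases "y0 = 0")
      case True
      then have "?f 0 \<in> set mu"
        using \<open>y0 \<in> set cr\<close> ty(3) by auto
      then show False
        using bounds[of "?f 0"] gf[of 0] g0 lt True by simp
    next
      case False
      have "0 \<in> {..<n} - set (c0 # cr)"
        using sc False sv bn by auto
      then have "?f 0 \<in># image_mset ?f (mset_set ({..<n} - set (c0 # cr)))"
        by simp
      then have "?f 0 \<in> set ls"
        unfolding ty(4) by simp
      then have "?f 0 \<le> l0"
        using srt(1) lam by auto
      then show False
        using gf[of 0] g0 lt False by simp
    qed
  qed
  have mcr: "mset cr = mset v"
    using mc c0 by simp
  have crg: "map g cr = mu"
    using ty(1,3) c0 by (auto simp: gf)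
  have "mset mu = mset mu'"
    using mcr crg gm by (metis mset_map)
  then have mu_eq: "mu' = mu"
    using sorted_wrt_ge_unique srt(3,4) sorted_wrt_gt_imp_ge by metis
  have "distinct (map g v)"
    using srt(4) gm by (metis distinct_rev sorted_wrt_rev strict_sorted_iff)
  \<comment> \<open>Multiplicities separate the leg letters, so equal multiplicity lists mean equal
    legs.\<close>
  then have "inj_on g (set cr \<union> set v)"
    using mcr by (metis distinct_map mset_eq_setD sup.idem)
  moreover have "map g cr = map g v"
    using crg gm mu_eq by simp
  ultimately have "cr = v"
    by (metis map_inj_on)
  then have zy: "z = y"
    by (simp add: zs y_def c0)
  have "q x = x" for x
  proof (cases "x \<in> insert 0 {a + 1..<a + 1 + b}")
    case True
    \<comment> \<open>\<open>k\<close> turns a position of the first column into its index in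
      \<open>y0 # v\<close>: the corner 0 stays 0 and the first leg position \<open>a + 1\<close>
      becomes 1. The letters there are distinct, so \<open>q\<close> moves nothing.\<close>
    define k where "k i = (if i = 0 then 0 else i - a)" for i :: nat
    have yk: "y ! i = (y0 # v) ! k i" "k i < length (y0 # v)" if "i \<in> insert 0 {a + 1..<a + 1 + b}" for i
      using that lur lv by (auto simp: y_def k_def nth_append nth_Cons')
    have qx: "q x \<in> insert 0 {a + 1..<a + 1 + b}"
      using True by (simp only: permutes_in_image[OF q])
    have "x < length y"
      using True by (auto simp: y_def lur lv)
    then have "y ! q x = y ! x"
      using permute_list_nth[OF q', of x] zy z_def by simp
    then have "k (q x) = k x"
      using yk[OF True] yk[OF qx] nth_eq_iff_index_eq[OF dy] by metis
    then show ?thesis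
      using True qx by (auto simp: k_def split: if_splits)
  next
    case False
    then show ?thesis by (rule permutes_not_in[OF q])
  qed
  then have "q = id"
    by auto
  moreover have "lam' = lam"
  proof -
    have "{..<n} - set (c0 # cr) = {..<n - b} - {y0}"
      using sc sv bn by auto
    moreover have "image_mset ?f (mset_set ({..<n - b} - {y0})) = image_mset g (mset_set ({..<n - b} - {y0}))"
      by (rule image_mset_cong) (auto simp: gf)
    ultimately have "image_mset g (mset_set ({..<n - b} - {y0})) = mset ls"
      using ty(4) by simp
    moreover have "mset lam' = add_mset (g y0) (image_mset g (mset_set ({..<n - b} - {y0})))"
      using mset_set_remove_upt[OF y0, of g] gl by simp
    moreover have "g y0 = l0"
      using gf[of y0] ty(2) c0 l0 by simp
    ultimately have "mset lam' = mset lam"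
      using lam by simp
    then show ?thesis
      using sorted_wrt_ge_unique srt(1,2) by metis
  qed
  ultimately show ?thesis
    using mu_eq by simp
qed

subsection \<open>The multiplicity\<close>

interpretation complex_fun: vector_space "\<lambda>(c::complex) (f::'x \<Rightarrow> complex) x. c * f x"
  by unfold_locales (auto simp: fun_eq_iff algebra_simps)

lemma sum_fun_apply: "(\<Sum>i\<in>I. g i) x = (\<Sum>i\<in>I. g i x)" for g :: "'i \<Rightarrow> 'x \<Rightarrow> complex"
  by (induction I rule: infinite_finite_induct) auto

text \<open>The evaluations at the points \<open>e i\<close> separate \<open>V\<close> and are
  diagonal on the \<open>f i\<close>, so the \<open>f i\<close> form a basis.\<close>

lemma complex_fun_dim_eq_card:
  fixes V :: "('x \<Rightarrow> complex) set" and e :: "'i \<Rightarrow> 'x" and f :: "'i \<Rightarrow> 'x \<Rightarrow> complex"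
  assumes V: "complex_fun.subspace V" and fin: "finite A" and fV: "\<And>i. i \<in> A \<Longrightarrow> f i \<in> V"
    and diag: "\<And>i. i \<in> A \<Longrightarrow> f i (e i) \<noteq> 0"
    and off: "\<And>i j. i \<in> A \<Longrightarrow> j \<in> A \<Longrightarrow> i \<noteq> j \<Longrightarrow> f i (e j) = 0"
    and sep: "\<And>T. T \<in> V \<Longrightarrow> (\<And>i. i \<in> A \<Longrightarrow> T (e i) = 0) \<Longrightarrow> T = 0"
  shows "complex_fun.dim V = card A"
proof (rule complex_fun.dim_unique)
  have inj: "inj_on f A"
    using diag off by (metis inj_onI)
  have ev: "(\<Sum>i\<in>A. c i * f i (e j)) = c j * f j (e j)" if "j \<in> A" for c j
  proof -
    have "(\<Sum>i\<in>A. c i * f i (e j)) = (\<Sum>i\<in>A. if i = j then c j * f j (e j) else 0)"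
      by (rule sum.cong) (use off that in auto)
    then show ?thesis
      using fin that by simp
  qed
  show "f ` A \<subseteq> V"
    using fV by auto
  show "V \<subseteq> complex_fun.span (f ` A)"
  proof
    fix T assume T: "T \<in> V"
    \<comment> \<open>The interpolant of \<open>T\<close> at the points \<open>e i\<close>; the
      difference vanishes at all of them and is zero by separation.\<close>
    define S where "S = (\<Sum>i\<in>A. (\<lambda>x. T (e i) / f i (e i) * f i x))"
    have "S \<in> V"
      unfolding S_def by (intro complex_fun.subspace_sum complex_fun.subspace_scale V fV)
    then have "T - S \<in> V"
      by (intro complex_fun.subspace_diff V T)
    moreover have "(T - S) (e j) = 0" if "j \<in> A" for j
      using ev[OF that, of "\<lambda>i. T (e i) / f i (e i)"] diag[OF that] by (simp add: S_def sum_fun_apply)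
    ultimately have "T = S"
      using sep[of "T - S"] by simp
    moreover have "S \<in> complex_fun.span (f ` A)"
      unfolding S_def by (intro complex_fun.span_sum complex_fun.span_scale complex_fun.span_base) auto
    ultimately show "T \<in> complex_fun.span (f ` A)"
      by simp
  qed
  show "complex_fun.independent (f ` A)"
  proof (rule complex_fun.independent_if_scalars_zero)
    show "finite (f ` A)"
      using fin by simp
    fix c g assume s: "(\<Sum>g\<in>f ` A. (\<lambda>x. c g * g x)) = 0" and "g \<in> f ` A"
    then obtain j where j: "j \<in> A" "g = f j"
      by auto
    have "0 = (\<Sum>i\<in>A. (\<lambda>x. c (f i) * f i x)) (e j)"
      using s by (simp add: sum.reindex[OF inj] o_def)
    also have "\<dots> = c (f j) * f j (e j)"
      using ev[OF j(1)] by (simp add: sum_fun_apply)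
    finally show "c g = 0"
      using diag j by simp
  qed
  show "card (f ` A) = card A"
    using inj by (rule card_image)
qed

lemma young_sym_add: "young_sym \<nu> (X + Y) = young_sym \<nu> X + young_sym \<nu> Y"
  by (auto simp: young_sym_def pos_act_def fun_eq_iff algebra_simps sum.distrib)

lemma young_sym_scale: "young_sym \<nu> (\<lambda>x. c * X x) = (\<lambda>x. c * young_sym \<nu> X x)"
  by (auto simp: young_sym_def pos_act_def fun_eq_iff algebra_simps sum_distrib_left)

lemma young_sym_zero: "young_sym \<nu> 0 = 0"
  by (auto simp: young_sym_def pos_act_def fun_eq_iff)

lemma subspace_hook_invariants: "complex_fun.subspace (hook_invariants a b n)"
proof (rule complex_fun.subspaceI)
  have "0 \<in> weyl_module (hook a b) n"
    unfolding weyl_module_def by (rule image_eqI[of _ _ 0]) (auto simp: young_sym_zero tensors_def)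
  then show "0 \<in> hook_invariants a b n"
    by (auto simp: hook_invariants_def perm_act_def fun_eq_iff)
next
  fix S T assume S: "S \<in> hook_invariants a b n" and T: "T \<in> hook_invariants a b n"
  obtain X Y where X: "X \<in> tensors n (sum_list (hook a b))" "S = young_sym (hook a b) X"
    and Y: "Y \<in> tensors n (sum_list (hook a b))" "T = young_sym (hook a b) Y"
    using S T by (auto simp: hook_invariants_def weyl_module_def)
  have "S + T \<in> weyl_module (hook a b) n"
    unfolding weyl_module_def by (rule image_eqI[of _ _ "X + Y"]) (use X Y in \<open>auto simp: young_sym_add tensors_def\<close>)
  then show "S + T \<in> hook_invariants a b n"
    using S T by (auto simp: hook_invariants_def perm_act_def fun_eq_iff)
next
  fix c T assume T: "T \<in> hook_invariants a b n"
  obtain Y where Y: "Y \<in> tensors n (sum_list (hook a b))" "T = young_sym (hook a b) Y"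
    using T by (auto simp: hook_invariants_def weyl_module_def)
  have "(\<lambda>x. c * T x) \<in> weyl_module (hook a b) n"
    unfolding weyl_module_def by (rule image_eqI[of _ _ "\<lambda>x. c * Y x"]) (use Y in \<open>auto simp: young_sym_scale tensors_def\<close>)
  then show "(\<lambda>x. c * T x) \<in> hook_invariants a b n"
    using T by (auto simp: hook_invariants_def perm_act_def fun_eq_iff)
qed

lemma finite_hook_pairs: "finite (hook_pairs a b n)"
proof (rule finite_subset)
  let ?L = "\<lambda>m. {xs. set xs \<subseteq> {..a + 1} \<and> length xs = m}"
  show "hook_pairs a b n \<subseteq> ?L (n - b) \<times> ?L b"
  proof clarsimp
    fix lam mu assume A: "(lam, mu) \<in> hook_pairs a b n"
    have "x \<le> Suc a" if "x \<in> set lam \<or> x \<in> set mu" for x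
      using member_le_sum_list[of x lam] member_le_sum_list[of x mu] that A
      by (auto simp: hook_pairs_def)
    then show "set lam \<subseteq> {..Suc a} \<and> length lam = n - b \<and> set mu \<subseteq> {..Suc a} \<and> length mu = b"
      using A by (auto simp: hook_pairs_def)
  qed
  show "finite (?L (n - b) \<times> ?L b)"
    by (intro finite_cartesian_product finite_lists_length_eq) auto
qed

definition hook_indicator :: "nat \<Rightarrow> nat \<Rightarrow> nat \<Rightarrow> nat list \<times> nat list \<Rightarrow> nat list \<Rightarrow> complex" where
  "hook_indicator a b n P w = of_bool (hook_type a b n (fst P) (snd P) w)"

text \<open>Only \<open>q = id\<close> contributes, with sign 1, so the value counts row
  permutations. At the matching pair the identity is among them; at any other pair there are
  none.\<close>

lemma young_sym_hook_indicator_canon_word: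
  assumes A: "(lam, mu) \<in> hook_pairs a b n" and A': "(lam', mu') \<in> hook_pairs a b n" and bn: "b + 1 \<le> n"
  shows "young_sym (hook a b) (hook_indicator a b n (lam, mu)) (canon_word lam' mu') = 0
    \<longleftrightarrow> (lam', mu') \<noteq> (lam, mu)"
proof -
  let ?w = "canon_word lam' mu'" and ?R = "{p. p permutes {..<a + 1}}"
  let ?C = "{q. q permutes insert 0 {a + 1..<a + 1 + b}}"
  let ?t = "hook_type a b n lam mu"
  obtain u where u: "?w = (0 # u) @ [n - b..<n]" "length u = a"
    by (rule canon_word_split[OF A' bn])
  have w: "length ?w = a + 1 + b"
    using u bn by simp
  have key: "q = id \<and> lam' = lam \<and> mu' = mu"
    if "p \<in> ?R" "q \<in> ?C" "?t (permute_list (p \<circ> q) ?w)" for p q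
    using hook_type_permuted_canon_word[OF A A' bn, of p q] that by auto
  have "young_sym (hook a b) (hook_indicator a b n (lam, mu)) ?w
     = (\<Sum>p\<in>?R. \<Sum>q\<in>?C. if q = id then of_bool (?t (permute_list p ?w)) else 0)"
    unfolding young_sym_hook[OF w]
  proof (intro sum.cong refl)
    fix p q assume "p \<in> ?R" "q \<in> ?C"
    then show "of_int (sign q) * hook_indicator a b n (lam, mu) (permute_list (p \<circ> q) ?w)
       = (if q = id then of_bool (?t (permute_list p ?w)) else 0)"
      using key[of p q] by (auto simp: hook_indicator_def sign_id)
  qed
  also have "\<dots> = (\<Sum>p\<in>?R. of_bool (?t (permute_list p ?w)))"
    by (rule sum.cong[OF refl]) (simp add: finite_permutations)
  also have "\<dots> = of_nat (card {p \<in> ?R. ?t (permute_list p ?w)})"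
    by (simp add: of_bool_def sum.If_cases finite_permutations Int_def)
  finally have eq: "young_sym (hook a b) (hook_indicator a b n (lam, mu)) ?w
     = of_nat (card {p \<in> ?R. ?t (permute_list p ?w)})" .
  have fin: "finite {p \<in> ?R. ?t (permute_list p ?w)}"
    by (simp add: finite_permutations)
  show ?thesis
  proof (cases "(lam', mu') = (lam, mu)")
    case True
    then have "id \<in> {p \<in> ?R. ?t (permute_list p ?w)}"
      using hook_type_canon_word[OF A bn] by simp
    then have "card {p \<in> ?R. ?t (permute_list p ?w)} \<noteq> 0"
      using fin by (metis card_0_eq empty_iff)
    then show ?thesis
      using True eq by (simp only: of_nat_eq_0_iff) simp
  next
    case False
    have "?t (permute_list p ?w) \<Longrightarrow> False" if "p \<in> ?R" for p
      using key[of p id] that False by simp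
    then have "{p \<in> ?R. ?t (permute_list p ?w)} = {}"
      by blast
    then show ?thesis
      using False eq by (simp only: card.empty of_nat_0) simp
  qed
qed

theorem theoremC:
  fixes a b n :: nat
  assumes "b + 1 \<le> n"
  shows "triv_mult (hook a b) n =
    card {(lam :: nat list, mu :: nat list).
       length lam = n - b \<and> sorted_wrt (\<ge>) lam \<and>
       length mu = b \<and> sorted_wrt (>) mu \<and>
       sum_list lam + sum_list mu = a + 1 \<and>
       (b = 0 \<or> mu ! 0 + 1 < lam ! 0)}"
proof -
  have "complex_fun.dim (hook_invariants a b n) = card (hook_pairs a b n)"
  \<comment> \<open>The evaluation points are the canonical words of the dominant pairs, and the
    symmetrized indicators are the dual elements.\<close>
  proof (rule complex_fun_dim_eq_card[where e = "\<lambda>(lam, mu). canon_word lam mu"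
        and f = "\<lambda>P. young_sym (hook a b) (hook_indicator a b n P)"])
    show "complex_fun.subspace (hook_invariants a b n)"
      by (rule subspace_hook_invariants)
    show "finite (hook_pairs a b n)"
      by (rule finite_hook_pairs)
  next
    fix P assume "P \<in> hook_pairs a b n"
    show "young_sym (hook a b) (hook_indicator a b n P) \<in> hook_invariants a b n"
    proof (rule young_sym_invariant)
      show "hook_indicator a b n P \<in> tensors n (a + 1 + b)"
        by (auto simp: tensors_def hook_indicator_def hook_type_def)
    qed (simp add: hook_indicator_def hook_type_map_iff)
  next
    fix P assume "P \<in> hook_pairs a b n"
    then show "young_sym (hook a b) (hook_indicator a b n P) (case P of (lam, mu) \<Rightarrow> canon_word lam mu) \<noteq> 0"
      using assms by (cases P) (simp add: young_sym_hook_indicator_canon_word)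
  next
    fix P Q assume "P \<in> hook_pairs a b n" "Q \<in> hook_pairs a b n" "P \<noteq> Q"
    then show "young_sym (hook a b) (hook_indicator a b n P) (case Q of (lam, mu) \<Rightarrow> canon_word lam mu) = 0"
      using assms by (cases P; cases Q) (auto simp: young_sym_hook_indicator_canon_word)
  next
    fix T assume T: "T \<in> hook_invariants a b n"
      and z: "\<And>P. P \<in> hook_pairs a b n \<Longrightarrow> T (case P of (lam, mu) \<Rightarrow> canon_word lam mu) = 0"
    interpret hook_invariant a b n T
      using T by (rule hook_invariants_hook_invariant)
    have "T w = 0" for w
    proof (cases "w \<in> words n (a + 1 + b)")
      case True
      then show ?thesis
        by (rule vanishes[rotated]) (use z in fastforce)
    next
      case False
      \<comment> \<open>Outside the admissible words a tensor vanishes by its support.\<close>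
      have "T \<in> tensors n (a + 1 + b)"
        using T young_sym_supp by (auto simp: hook_invariants_def weyl_module_def sum_list_hook)
      then show ?thesis
        using False by (simp add: tensors_def)
    qed
    then show "T = 0"
      by auto
  qed
  then show ?thesis
    by (simp add: triv_mult_def hook_invariants_def hook_pairs_def)
qed

end
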